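(* Suppose that $X\subseteq\mathbb{R}^{mn}$ is convex and closed, that the solution set $D^*$ of the problem $\min\{f(x) : x\in X,\ Ax=b\}$ is nonempty, and that $f:\mathbb{R}^{mn}\to\mathbb{R}$ is convex. Suppose that the set $F^*\cap F_I$ is nonempty for some $I\subseteq L$. Then $F^*\cap F_I=D^*_I$ and $\mathbf{0}\in Y^*_I$.
   Context: Let $m,n,l$ be positive integers and $L=\{1,\dots,l\}$. Let $X\subseteq\mathbb{R}^{mn}$, $f:\mathbb{R}^{mn}\to\mathbb{R}$, let $A$ be a real matrix with $ln$ rows and $mn$ columns consisting of stacked $n\times mn$ blocks $A_1,\dots,A_l$, and let $b=(b_i)_{i\in L}\in\mathbb{R}^{ln}$ with $b_i\in\mathbb{R}^n$. For $I\subseteq L$, $A_I$ is the matrix of stacked blocks $A_i$, $i\in I$, $b_I=(b_i)_{i\in I}$, and $F_I=\{x\in\mathbb{R}^{mn}: A_Ix=b_I\}$ ($F_\varnothing=\mathbb{R}^{mn}$). $D^*_I$ is the solution set of $\min\{f(x): x\in X\cap F_I\}$, and $F^*$ is the solution set of $\min\{f(x): x\in X\}$. Lagrange function: $\mathcal{L}(x,y)=f(x)+\langle y,Ax-b\rangle$. For $I\subseteq L$ let $Y_I=\{y=(y_i)_{i\in L}\in\mathbb{R}^{ln} : y_i=\mathbf{0}\in\mathbb{R}^n \text{ for } i\notin I\}$. A pair $(x^*,y^* )\in X\times Y_I$ is a saddle point for index set $I$ if $\mathcal{L}(x^*,y)\le\mathcal{L}(x^*,y^* )\le\mathcal{L}(x,y^*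 )$ for all $y\in Y_I$ and all $x\in X$. The set of saddle points for $I$ is $W^*_I=D^*_I\times Y^*_I$, where $Y^*_I$ is the set of Lagrange multipliers, i.e. of those $y^*\in Y_I$ for which $(x^*,y^* )$ is a saddle point for $I$ for some $x^*\in X$. *)

theory Defs
  imports "HOL-Analysis.Analysis"
begin

text \<open>
  The spaces \<open>\<real>\<^sup>m\<^sup>n\<close> and \<open>\<real>\<^sup>l\<^sup>n\<close> are rendered as
  \<^typ>\<open>real ^ ('m \<times> 'n)\<close> and \<^typ>\<open>real ^ ('l \<times> 'n)\<close>.  A coordinate of the latter is a pair
  of a block number and a position in the block, and \<open>UNIV :: 'l set\<close> plays the role of
  \<open>L = {1, \<dots>, l}\<close>.
\<close>

definition block_vec :: "real ^ ('l::finite \<times> 'n::finite) \<Rightarrow> 'l \<Rightarrow> real ^ 'n"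
  where "block_vec v i = (\<chi> r. v $ (i, r))"

definition block_mat ::
    "real ^ 'k ^ ('l::finite \<times> 'n::finite) \<Rightarrow> 'l \<Rightarrow> real ^ 'k::finite ^ 'n"
  where "block_mat A i = (\<chi> r. A $ (i, r))"

definition solution_set :: "('a \<Rightarrow> real) \<Rightarrow> 'a set \<Rightarrow> 'a set"
  where "solution_set f S = {x. is_arg_min f (\<lambda>z. z \<in> S) x}"

text \<open>
  The stacked system \<open>A\<^sub>I x = b\<^sub>I\<close> is stated blockwise, since its number of rows depends on the
  set \<open>I\<close>.
\<close>

definition F_set ::
    "real ^ 'k::finite ^ ('l::finite \<times> 'n::finite) \<Rightarrow> real ^ ('l \<times> 'n) \<Rightarrow> 'l set \<Rightarrow> (real ^ 'k) set"
  where "F_set A b I = {x. \<forall>i\<in>I. block_mat A i *v x = block_vec b i}"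

definition D_star ::
    "(real ^ 'k \<Rightarrow> real) \<Rightarrow> (real ^ 'k) set \<Rightarrow> real ^ 'k::finite ^ ('l::finite \<times> 'n::finite)
      \<Rightarrow> real ^ ('l \<times> 'n) \<Rightarrow> 'l set \<Rightarrow> (real ^ 'k) set"
  where "D_star f X A b I = solution_set f (X \<inter> F_set A b I)"

definition lagrangian ::
    "(real ^ 'k \<Rightarrow> real) \<Rightarrow> real ^ 'k::finite ^ ('l::finite \<times> 'n::finite) \<Rightarrow> real ^ ('l \<times> 'n)
      \<Rightarrow> real ^ 'k \<Rightarrow> real ^ ('l \<times> 'n) \<Rightarrow> real"
  where "lagrangian f A b x y = f x + y \<bullet> (A *v x - b)"

definition Y_set :: "'l set \<Rightarrow> (real ^ ('l::finite \<times> 'n::finite)) set"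
  where "Y_set I = {y. \<forall>i. i \<notin> I \<longrightarrow> block_vec y i = 0}"

definition saddle_point ::
    "(real ^ 'k \<Rightarrow> real) \<Rightarrow> (real ^ 'k) set \<Rightarrow> real ^ 'k::finite ^ ('l::finite \<times> 'n::finite)
      \<Rightarrow> real ^ ('l \<times> 'n) \<Rightarrow> 'l set \<Rightarrow> real ^ 'k \<Rightarrow> real ^ ('l \<times> 'n) \<Rightarrow> bool"
  where "saddle_point f X A b I xs ys \<longleftrightarrow>
    xs \<in> X \<and> ys \<in> Y_set I \<and>
    (\<forall>y\<in>Y_set I. lagrangian f A b xs y \<le> lagrangian f A b xs ys) \<and>
    (\<forall>x\<in>X. lagrangian f A b xs ys \<le> lagrangian f A b x ys)"

definition Y_star ::
    "(real ^ 'k \<Rightarrow> real) \<Rightarrow> (real ^ 'k) set \<Rightarrow> real ^ 'k::finite ^ ('l::finite \<times> 'n::finite)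
      \<Rightarrow> real ^ ('l \<times> 'n) \<Rightarrow> 'l set \<Rightarrow> (real ^ ('l \<times> 'n)) set"
  where "Y_star f X A b I = {ys \<in> Y_set I. \<exists>xs\<in>X. saddle_point f X A b I xs ys}"

end

theory Submission
  imports Defs
begin

text \<open>
  The constraints indexed by \<open>I\<close> are inactive: some unconstrained minimiser over \<open>X\<close> happens to
  satisfy them, so imposing them does not raise the minimum, and the minimisers of the constrained
  problem are exactly the unconstrained ones that are feasible.  A constraint that costs nothing
  has price zero: at such a point \<open>xs\<close> the penalty \<open>y \<bullet> (A *v xs - b)\<close> vanishes for every
  admissible multiplier \<open>y\<close>, while at \<open>y = 0\<close> the Lagrangian is \<open>f\<close> itself, which \<open>xs\<close> minimises
  over \<open>X\<close>.  Hence \<open>(xs, 0)\<close> is a saddle point.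
\<close>

text \<open>
  A minimiser over \<open>S\<close> that lies in \<open>T\<close> shows that both problems have the same optimal value.
\<close>

lemma solution_set_Int_eq_if_attained:
  assumes "solution_set f S \<inter> T \<noteq> {}"
  shows "solution_set f S \<inter> T = solution_set f (S \<inter> T)"
proof -
  obtain p where p: "p \<in> S" "p \<in> T" and p_min: "\<And>z. z \<in> S \<Longrightarrow> f p \<le> f z"
    using assms by (auto simp: solution_set_def is_arg_min_linorder)
  show ?thesis
  proof
    show "solution_set f S \<inter> T \<subseteq> solution_set f (S \<inter> T)"
      by (auto simp: solution_set_def is_arg_min_linorder)
    show "solution_set f (S \<inter> T) \<subseteq> solution_set f S \<inter> T"
    proof
      fix x assume "x \<in> solution_set f (S \<inter> T)"
      then have "x \<in> S" "x \<in> T" "f x \<le> f p"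
        using p by (auto simp: solution_set_def is_arg_min_linorder)
      then show "x \<in> solution_set f S \<inter> T"
        using p_min by (auto simp: solution_set_def is_arg_min_linorder intro: order_trans)
    qed
  qed
qed

text \<open>
  In every coordinate \<open>(i, r)\<close> one of the two factors vanishes: the multiplier if \<open>i \<notin> I\<close>, the
  residual if \<open>i \<in> I\<close>.
\<close>

lemma multiplier_orthogonal_residual:
  assumes "y \<in> Y_set I" and "x \<in> F_set A b I"
  shows "y \<bullet> (A *v x - b) = 0"
proof -
  have "y $ k * (A *v x - b) $ k = 0" for k
  proof (cases k)
    case (Pair i r)
    show ?thesis
    proof (cases "i \<in> I")
      case True
      then have "(block_mat A i *v x) $ r = block_vec b i $ r"
        using assms(2) by (simp add: F_set_def)
      then show ?thesis
        by (simp add: Pair block_mat_def block_vec_def matrix_vector_mult_def)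
    next
      case False
      then have "block_vec y i $ r = 0"
        using assms(1) by (simp add: Y_set_def)
      then show ?thesis
        by (simp add: Pair block_vec_def)
    qed
  qed
  then show ?thesis
    unfolding inner_vec_def inner_real_def by (intro sum.neutral ballI)
qed

lemma zero_in_Y_set: "0 \<in> Y_set I"
  by (simp add: Y_set_def block_vec_def vec_eq_iff)

lemma saddle_point_zero_multiplier:
  assumes "xs \<in> solution_set f X" and "xs \<in> F_set A b I"
  shows "saddle_point f X A b I xs 0"
  using assms zero_in_Y_set multiplier_orthogonal_residual[OF _ assms(2)]
  by (auto simp: saddle_point_def lagrangian_def solution_set_def is_arg_min_linorder)

theorem proposition2:
  fixes X :: "(real ^ ('m::finite \<times> 'n::finite)) set"
    and f :: "real ^ ('m \<times> 'n) \<Rightarrow> real"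
    and A :: "real ^ ('m \<times> 'n) ^ ('l::finite \<times> 'n)"
    and b :: "real ^ ('l \<times> 'n)"
    and I :: "'l set"
  assumes "convex X" and "closed X"
    and "solution_set f (X \<inter> {x. A *v x = b}) \<noteq> {}"
    and "convex_on UNIV f"
    and "solution_set f X \<inter> F_set A b I \<noteq> {}"
  shows "solution_set f X \<inter> F_set A b I = D_star f X A b I \<and> 0 \<in> Y_star f X A b I"
proof
  show "solution_set f X \<inter> F_set A b I = D_star f X A b I"
    unfolding D_star_def by (rule solution_set_Int_eq_if_attained[OF assms(5)])
  obtain xs where "xs \<in> solution_set f X" "xs \<in> F_set A b I"
    using assms(5) by blast
  then have "saddle_point f X A b I xs 0"
    by (rule saddle_point_zero_multiplier)
  then show "0 \<in> Y_star f X A b I"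
    by (auto simp: Y_star_def saddle_point_def)
qed

end
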